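(* Let $(X,S)$ be an $S$-metric space, let $\mathcal{I}$ be an admissible ideal of $\mathbb{N}$, and let $M\subset X$. If a sequence $\{x_n\}_{n\in\mathbb{N}}$ in $X$ is $\mathcal{I}^*$-localized on $M$, then $\{x_n\}_{n\in\mathbb{N}}$ is $\mathcal{I}$-localized on $M$; moreover $loc_{\mathcal{I}^*}(x_n)\subset loc_{\mathcal{I}}(x_n)$.
   Context: An $S$-metric on a nonempty set $X$ is a function $S:X\times X\times X\to[0,\infty)$ such that for all $x,y,z,a\in X$: (i) $S(x,y,z)\ge 0$; (ii) $S(x,y,z)=0$ if and only if $x=y=z$; (iii) $S(x,y,z)\le S(x,x,a)+S(y,y,a)+S(z,z,a)$. The pair $(X,S)$ is called an $S$-metric space. An ideal $\mathcal{I}$ of $\mathbb{N}$ is a collection of subsets of $\mathbb{N}$ closed under finite unions and under taking subsets; it is non-trivial if it is neither $\{\emptyset\}$ nor $2^{\mathbb{N}}$, and admissible if it is non-trivial and $\{n\}\in\mathcal{I}$ for every $n\in\mathbb{N}$. The associated filter is $\mathcal{F}(\mathcal{I})=\{A\subset\mathbb{N}:\mathbb{N}\setminus A\in\mathcal{I}\}$. A real sequence $\{a_n\}_{n\in\mathbb{N}}$ is $\mathcal{I}$-convergent to $a\in\mathbb{R}$ if $\{n\in\mathbb{N}:|a_n-a|\ge\varepsilon\}\in\mathcal{I}$ for every $\varepsilon>0$. It is $\mathcal{I}^*$-convergent to $a$ if there is a set $\{m_1<m_2<\cdots\}\in\mathcal{F}(\mathcal{I})$ with $\lim_{k\to\infty}a_{m_k}=a$.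 A sequence $\{x_n\}$ in $X$ is $\mathcal{I}$-localized (respectively $\mathcal{I}^*$-localized) on $M\subset X$ if for each $x\in M$ the real sequence $\{S(x_n,x_n,x)\}_{n\in\mathbb{N}}$ is $\mathcal{I}$-convergent (respectively $\mathcal{I}^*$-convergent). The locators $loc_{\mathcal{I}}(x_n)$ and $loc_{\mathcal{I}^*}(x_n)$ are the maximal subsets of $X$ on which $\{x_n\}$ is $\mathcal{I}$-localized and $\mathcal{I}^*$-localized, respectively. *)

theory Defs
  imports Complex_Main
begin

locale S_metric_space =
  fixes X :: "'a set" and S :: "'a \<Rightarrow> 'a \<Rightarrow> 'a \<Rightarrow> real"
  assumes nonempty: "X \<noteq> {}"
    and nonneg: "\<lbrakk>x \<in> X; y \<in> X; z \<in> X\<rbrakk> \<Longrightarrow> 0 \<le> S x y z"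
    and eq_0_iff: "\<lbrakk>x \<in> X; y \<in> X; z \<in> X\<rbrakk> \<Longrightarrow> S x y z = 0 \<longleftrightarrow> x = y \<and> y = z"
    and triangle: "\<lbrakk>x \<in> X; y \<in> X; z \<in> X; a \<in> X\<rbrakk> \<Longrightarrow> S x y z \<le> S x x a + S y y a + S z z a"

(* The empty union is counted among the finite unions, hence {} \<in> I. *)
definition set_ideal :: "nat set set \<Rightarrow> bool" where
  "set_ideal I \<longleftrightarrow> {} \<in> I \<and> (\<forall>A\<in>I. \<forall>B\<in>I. A \<union> B \<in> I) \<and> (\<forall>A\<in>I. \<forall>B. B \<subseteq> A \<longrightarrow> B \<in> I)"

definition nontrivial_ideal :: "nat set set \<Rightarrow> bool" where
  "nontrivial_ideal I \<longleftrightarrow> set_ideal I \<and> I \<noteq> {{}} \<and> I \<noteq> Pow UNIV"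

definition admissible_ideal :: "nat set set \<Rightarrow> bool" where
  "admissible_ideal I \<longleftrightarrow> nontrivial_ideal I \<and> (\<forall>n. {n} \<in> I)"

definition ideal_filter :: "nat set set \<Rightarrow> nat set set" where
  "ideal_filter I = {A. UNIV - A \<in> I}"

definition I_convergent_to :: "nat set set \<Rightarrow> (nat \<Rightarrow> real) \<Rightarrow> real \<Rightarrow> bool" where
  "I_convergent_to I a l \<longleftrightarrow> (\<forall>\<epsilon>>0. {n. \<bar>a n - l\<bar> \<ge> \<epsilon>} \<in> I)"

definition Istar_convergent_to :: "nat set set \<Rightarrow> (nat \<Rightarrow> real) \<Rightarrow> real \<Rightarrow> bool" where
  "Istar_convergent_to I a l \<longleftrightarrow>
     (\<exists>m :: nat \<Rightarrow> nat. strict_mono m \<and> range m \<in> ideal_filter I \<and> (\<lambda>k. a (m k)) \<longlonglongrightarrow> l)"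

definition I_localized_on ::
    "('a \<Rightarrow> 'a \<Rightarrow> 'a \<Rightarrow> real) \<Rightarrow> nat set set \<Rightarrow> (nat \<Rightarrow> 'a) \<Rightarrow> 'a set \<Rightarrow> bool" where
  "I_localized_on S I x M \<longleftrightarrow> (\<forall>y\<in>M. \<exists>l. I_convergent_to I (\<lambda>n. S (x n) (x n) y) l)"

definition Istar_localized_on ::
    "('a \<Rightarrow> 'a \<Rightarrow> 'a \<Rightarrow> real) \<Rightarrow> nat set set \<Rightarrow> (nat \<Rightarrow> 'a) \<Rightarrow> 'a set \<Rightarrow> bool" where
  "Istar_localized_on S I x M \<longleftrightarrow> (\<forall>y\<in>M. \<exists>l. Istar_convergent_to I (\<lambda>n. S (x n) (x n) y) l)"

definition maximal_subset :: "'a set \<Rightarrow> ('a set \<Rightarrow> bool) \<Rightarrow> 'a set \<Rightarrow> bool" where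
  "maximal_subset X P L \<longleftrightarrow> L \<subseteq> X \<and> P L \<and> (\<forall>N. N \<subseteq> X \<and> P N \<and> L \<subseteq> N \<longrightarrow> N = L)"

(* The descriptions are proper: see maximal_I_localized and maximal_Istar_localized below. *)
definition I_locator ::
    "'a set \<Rightarrow> ('a \<Rightarrow> 'a \<Rightarrow> 'a \<Rightarrow> real) \<Rightarrow> nat set set \<Rightarrow> (nat \<Rightarrow> 'a) \<Rightarrow> 'a set" where
  "I_locator X S I x = (THE L. maximal_subset X (I_localized_on S I x) L)"

definition Istar_locator ::
    "'a set \<Rightarrow> ('a \<Rightarrow> 'a \<Rightarrow> 'a \<Rightarrow> real) \<Rightarrow> nat set set \<Rightarrow> (nat \<Rightarrow> 'a) \<Rightarrow> 'a set" where
  "Istar_locator X S I x = (THE L. maximal_subset X (Istar_localized_on S I x) L)"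

lemma maximal_subset_pointwise:
  "maximal_subset X (\<lambda>M. \<forall>y\<in>M. Q y) L \<longleftrightarrow> L = {y \<in> X. Q y}"
proof
  assume L: "maximal_subset X (\<lambda>M. \<forall>y\<in>M. Q y) L"
  then have "L \<subseteq> {y \<in> X. Q y}"
    unfolding maximal_subset_def by blast
  moreover have "\<forall>N. N \<subseteq> X \<and> (\<forall>y\<in>N. Q y) \<and> L \<subseteq> N \<longrightarrow> N = L"
    using L unfolding maximal_subset_def by blast
  ultimately show "L = {y \<in> X. Q y}"
    by (metis (no_types, lifting) mem_Collect_eq subsetI)
next
  assume "L = {y \<in> X. Q y}"
  then show "maximal_subset X (\<lambda>M. \<forall>y\<in>M. Q y) L"
    unfolding maximal_subset_def by blast
qed

lemma maximal_I_localized: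
  "maximal_subset X (I_localized_on S I x) L \<longleftrightarrow>
     L = {y \<in> X. \<exists>l. I_convergent_to I (\<lambda>n. S (x n) (x n) y) l}"
  unfolding I_localized_on_def[abs_def] by (rule maximal_subset_pointwise)

lemma maximal_Istar_localized:
  "maximal_subset X (Istar_localized_on S I x) L \<longleftrightarrow>
     L = {y \<in> X. \<exists>l. Istar_convergent_to I (\<lambda>n. S (x n) (x n) y) l}"
  unfolding Istar_localized_on_def[abs_def] by (rule maximal_subset_pointwise)

end

theory Submission
  imports Defs
begin

lemma admissible_ideal_subset:
  "\<lbrakk>admissible_ideal I; A \<in> I; B \<subseteq> A\<rbrakk> \<Longrightarrow> B \<in> I"
  unfolding admissible_ideal_def nontrivial_ideal_def set_ideal_def by blast

lemma admissible_ideal_union: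
  "\<lbrakk>admissible_ideal I; A \<in> I; B \<in> I\<rbrakk> \<Longrightarrow> A \<union> B \<in> I"
  unfolding admissible_ideal_def nontrivial_ideal_def set_ideal_def by blast

text \<open>A finite set is built from the empty set by adding singletons one at a time.
  Admissibility puts each singleton in \<open>I\<close>, and closure under unions does the
  rest.\<close>

lemma admissible_ideal_finite:
  assumes "admissible_ideal I" and "finite A"
  shows "A \<in> I"
  using assms(2)
proof (induction A rule: finite_induct)
  case empty
  show ?case
    using assms(1) unfolding admissible_ideal_def nontrivial_ideal_def set_ideal_def by blast
next
  case (insert n A)
  have "{n} \<in> I"
    using assms(1) unfolding admissible_ideal_def by blast
  then show ?case
    using admissible_ideal_union[OF assms(1) _ insert.IH] by force
qed

text \<open>The complement of \<open>range m\<close> lies in the ideal; on \<open>range m\<close> only finitely many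
  indices violate the \<open>\<epsilon>\<close>-bound, and an admissible ideal contains the finite sets.\<close>
lemma Istar_convergent_imp_I_convergent:
  assumes I: "admissible_ideal I" and conv: "Istar_convergent_to I a l"
  shows "I_convergent_to I a l"
  unfolding I_convergent_to_def
proof (intro allI impI)
  fix \<epsilon> :: real
  assume "\<epsilon> > 0"
  obtain m where m: "UNIV - range m \<in> I" and lim: "(\<lambda>k. a (m k)) \<longlonglongrightarrow> l"
    using conv unfolding Istar_convergent_to_def ideal_filter_def by blast
  obtain K where K: "\<And>k. k \<ge> K \<Longrightarrow> \<bar>a (m k) - l\<bar> < \<epsilon>"
    using LIMSEQ_D[OF lim \<open>\<epsilon> > 0\<close>] by auto
  have "{n. \<bar>a n - l\<bar> \<ge> \<epsilon>} \<subseteq> (UNIV - range m) \<union> m ` {..<K}"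
  proof
    fix n
    assume n: "n \<in> {n. \<bar>a n - l\<bar> \<ge> \<epsilon>}"
    show "n \<in> (UNIV - range m) \<union> m ` {..<K}"
    proof (cases "n \<in> range m")
      case True
      then obtain k where "n = m k" by blast
      \<comment> \<open>Otherwise the choice of \<open>K\<close> would place \<open>a n\<close>
        within \<epsilon> of \<open>l\<close>, against the choice of \<open>n\<close>.\<close>
      moreover from this have "k < K"
        using K[of k] n by (cases "k < K") auto
      ultimately show ?thesis by blast
    qed simp
  qed
  moreover have "(UNIV - range m) \<union> m ` {..<K} \<in> I"
    by (intro admissible_ideal_union[OF I m] admissible_ideal_finite[OF I]) simp
  ultimately show "{n. \<bar>a n - l\<bar> \<ge> \<epsilon>} \<in> I"
    using admissible_ideal_subset[OF I] by blast
qed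

text \<open>Being localized is a condition on each point separately, so the set of all good points
  is the only maximal one. The definite description therefore has the form
  \<open>THE L. L = A\<close> and collapses to \<open>A\<close>.\<close>

lemma I_locator_eq:
  "I_locator X S I x = {y \<in> X. \<exists>l. I_convergent_to I (\<lambda>n. S (x n) (x n) y) l}"
  unfolding I_locator_def maximal_I_localized by (rule the_eq_trivial)

lemma Istar_locator_eq:
  "Istar_locator X S I x = {y \<in> X. \<exists>l. Istar_convergent_to I (\<lambda>n. S (x n) (x n) y) l}"
  unfolding Istar_locator_def maximal_Istar_localized by (rule the_eq_trivial)

theorem theorem3p1:
  fixes X M :: "'a set"
    and S :: "'a \<Rightarrow> 'a \<Rightarrow> 'a \<Rightarrow> real"
    and I :: "nat set set"
    and x :: "nat \<Rightarrow> 'a"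
  assumes "S_metric_space X S"
    and "admissible_ideal I"
    and "M \<subseteq> X"
    and "range x \<subseteq> X"
  shows "(Istar_localized_on S I x M \<longrightarrow> I_localized_on S I x M)
    \<and> Istar_locator X S I x \<subseteq> I_locator X S I x"
  \<comment> \<open>With the locators as explicit sets, both claims reduce to one implication at
    each point \<open>y\<close>, and the same limit \<open>l\<close> serves as witness on both
    sides.\<close>
  unfolding Istar_localized_on_def I_localized_on_def I_locator_eq Istar_locator_eq
  using Istar_convergent_imp_I_convergent[OF assms(2)] by blast

end
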